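(* Let $G=(V,E)$ be a finite graph with $n=|V|\ge1$, and let $F(x)=n!\,P_G(x)$. For $k\ge 0$ let $A_k$ be the number of bijections $\pi:V\to\{1,\dots,n\}$ having exactly $k$ bad vertices. Then for every $k\ge 0$, $$A_k=\frac{F^{(k)}(-1)}{k!}.$$ In particular $A_0=\sigma(G)$, the number of successive vertex orderings of $G$.
   Context: For a bijection $\pi:V\to\{1,\dots,n\}$, a vertex $v$ is bad if $\pi(v)\ne1$ and $\pi(v)<\pi(u)$ for every neighbour $u$ of $v$. An ordering is successive if it has no bad vertex. For $I\subseteq V$ let $N(I)$ be the set of vertices adjacent to some vertex of $I$ and $a(I)=n-|I|-|N(I)|$. For independent sets $I$ (no two vertices adjacent) define $b(\varnothing)=1$ and $b(I)=\frac{1}{n-a(I)}\sum_{v\in I}b(I\setminus\{v\})$ for $I\ne\varnothing$, and $w(I)=\frac{a(I)}{n}b(I)$. The successive ordering polynomial is $P_G(x)=\sum_{I\ \text{independent}} w(I)\,x^{|I|}$. *)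

theory Defs
  imports
    Complex_Main
    "HOL-Library.FuncSet"
    "HOL-Computational_Algebra.Polynomial"
begin

definition finite_graph :: "'a set \<Rightarrow> 'a set set \<Rightarrow> bool" where
  "finite_graph V E \<longleftrightarrow> finite V \<and> (\<forall>e\<in>E. e \<subseteq> V \<and> card e = 2)"

definition adjacent :: "'a set set \<Rightarrow> 'a \<Rightarrow> 'a \<Rightarrow> bool" where
  "adjacent E u v \<longleftrightarrow> {u, v} \<in> E"

text \<open>Orderings are extensional functions, so that each bijection from \<open>V\<close> is counted once.\<close>

definition orderings :: "'a set \<Rightarrow> ('a \<Rightarrow> nat) set" where
  "orderings V = {\<pi> \<in> V \<rightarrow>\<^sub>E {1..card V}. bij_betw \<pi> V {1..card V}}"

definition bad_vertices :: "'a set \<Rightarrow> 'a set set \<Rightarrow> ('a \<Rightarrow> nat) \<Rightarrow> 'a set" where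
  "bad_vertices V E \<pi> =
     {v \<in> V. \<pi> v \<noteq> 1 \<and> (\<forall>u\<in>V. adjacent E u v \<longrightarrow> \<pi> v < \<pi> u)}"

definition successive :: "'a set \<Rightarrow> 'a set set \<Rightarrow> ('a \<Rightarrow> nat) \<Rightarrow> bool" where
  "successive V E \<pi> \<longleftrightarrow> bad_vertices V E \<pi> = {}"

definition num_successive :: "'a set \<Rightarrow> 'a set set \<Rightarrow> nat" where
  "num_successive V E = card {\<pi> \<in> orderings V. successive V E \<pi>}"

definition num_orderings_bad :: "'a set \<Rightarrow> 'a set set \<Rightarrow> nat \<Rightarrow> nat" where
  "num_orderings_bad V E k = card {\<pi> \<in> orderings V. card (bad_vertices V E \<pi>) = k}"

definition nbhd :: "'a set \<Rightarrow> 'a set set \<Rightarrow> 'a set \<Rightarrow> 'a set" where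
  "nbhd V E I = {u \<in> V. \<exists>v\<in>I. adjacent E u v}"

definition independent_sets :: "'a set \<Rightarrow> 'a set set \<Rightarrow> 'a set set" where
  "independent_sets V E = {I. I \<subseteq> V \<and> (\<forall>u\<in>I. \<forall>v\<in>I. \<not> adjacent E u v)}"

definition acoef :: "'a set \<Rightarrow> 'a set set \<Rightarrow> 'a set \<Rightarrow> real" where
  "acoef V E I = real (card V) - real (card I) - real (card (nbhd V E I))"

text \<open>The guard for infinite \<open>I\<close> only serves termination; see \<open>bcoef_rec\<close> below.\<close>

function bcoef :: "'a set \<Rightarrow> 'a set set \<Rightarrow> 'a set \<Rightarrow> real" where
  "bcoef V E I =
     (if I = {} then 1
      else if infinite I then 0
      else 1 / (real (card V) - acoef V E I) * (\<Sum>v\<in>I. bcoef V E (I - {v})))"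
  by pat_completeness auto
termination
  by (relation "measure (\<lambda>(V, E, I). card I)") (auto simp: card_gt_0_iff)

declare bcoef.simps [simp del]

lemma bcoef_empty: "bcoef V E {} = 1"
  by (simp add: bcoef.simps)

lemma bcoef_rec:
  assumes "I \<noteq> {}"
  shows "bcoef V E I = 1 / (real (card V) - acoef V E I) * (\<Sum>v\<in>I. bcoef V E (I - {v}))"
  using assms by (subst bcoef.simps) auto

definition wcoef :: "'a set \<Rightarrow> 'a set set \<Rightarrow> 'a set \<Rightarrow> real" where
  "wcoef V E I = acoef V E I / real (card V) * bcoef V E I"

definition successive_poly :: "'a set \<Rightarrow> 'a set set \<Rightarrow> real poly" where
  "successive_poly V E = (\<Sum>I\<in>independent_sets V E. monom (wcoef V E I) (card I))"

end

theory Submission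
  imports Defs
begin

text \<open>
  For an independent set \<open>I\<close>, exactly \<open>n! w(I)\<close> orderings have all vertices of \<open>I\<close> bad. To see
  this, remove the first vertex \<open>x\<close> of an ordering in which every vertex of \<open>I\<close> precedes its
  neighbours: \<open>x\<close> is not in \<open>N(I)\<close>, and what remains is such an ordering of \<open>V - {x}\<close> for
  \<open>I - {x}\<close>. As the weights \<open>b\<close> do not change when vertices outside \<open>N(I)\<close> are deleted, induction
  gives \<open>n! b(I)\<close> orderings of this kind; all of \<open>I\<close> is bad if moreover \<open>x\<close> is not in \<open>I\<close>, which
  leaves \<open>a(I)\<close> choices for \<open>x\<close>. Since the bad vertices of an ordering form an independent set,
  exchanging the sums over \<open>I\<close> and over the orderings \<open>\<pi>\<close> shows that \<open>F(x)\<close> is the sum of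
  \<open>(1 + x) ^ card (bad_vertices V E \<pi>)\<close> over all \<open>\<pi>\<close>. Hence \<open>A_k\<close> is the coefficient of \<open>x ^ k\<close>
  in \<open>F(x - 1)\<close>, which Taylor's formula expresses by the \<open>k\<close>-th derivative of \<open>F\<close> at \<open>-1\<close>.
\<close>

subsection \<open>Neighbourhoods and independent sets\<close>

lemma adjacent_commute: "adjacent E u v \<longleftrightarrow> adjacent E v u"
  by (simp add: adjacent_def insert_commute)

lemma nbhd_subset: "nbhd V E I \<subseteq> V"
  by (auto simp: nbhd_def)

lemma nbhd_mono: "J \<subseteq> I \<Longrightarrow> nbhd V E J \<subseteq> nbhd V E I"
  by (auto simp: nbhd_def)

lemma nbhd_Diff_vertex: "x \<notin> nbhd V E I \<Longrightarrow> nbhd (V - {x}) E I = nbhd V E I"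
  by (auto simp: nbhd_def)

lemma independent_sets_subset: "I \<in> independent_sets V E \<Longrightarrow> I \<subseteq> V"
  by (simp add: independent_sets_def)

lemma independent_sets_imp_finite: "finite V \<Longrightarrow> I \<in> independent_sets V E \<Longrightarrow> finite I"
  by (rule finite_subset[OF independent_sets_subset])

lemma independent_sets_mono:
  "I \<in> independent_sets V E \<Longrightarrow> J \<subseteq> I \<Longrightarrow> J \<in> independent_sets V E"
  by (auto simp: independent_sets_def)

lemma independent_sets_Diff_vertex:
  "I \<in> independent_sets V E \<Longrightarrow> I - {x} \<in> independent_sets (V - {x}) E"
  by (auto simp: independent_sets_def)

lemma independent_sets_disjoint_nbhd:
  "I \<in> independent_sets V E \<Longrightarrow> I \<inter> nbhd V E I = {}"
  by (auto simp: independent_sets_def nbhd_def)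

lemma finite_independent_sets: "finite V \<Longrightarrow> finite (independent_sets V E)"
  by (rule finite_subset[of _ "Pow V"]) (auto simp: independent_sets_def)

lemma bad_vertices_independent: "bad_vertices V E \<pi> \<in> independent_sets V E"
  unfolding bad_vertices_def independent_sets_def
  by (auto dest: adjacent_commute[THEN iffD1] less_asym)

lemma finite_bad_vertices: "finite V \<Longrightarrow> finite (bad_vertices V E \<pi>)"
  by (simp add: bad_vertices_def)

lemma acoef_eq_card:
  assumes "finite V" "I \<in> independent_sets V E"
  shows "acoef V E I = real (card (V - I - nbhd V E I))"
proof -
  have "finite I" "finite (nbhd V E I)"
    using independent_sets_imp_finite[OF assms] finite_subset[OF nbhd_subset assms(1)] .
  then have "card (I \<union> nbhd V E I) = card I + card (nbhd V E I)"
    using independent_sets_disjoint_nbhd[OF assms(2)] by (rule card_Un_disjoint)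
  moreover have covered: "I \<union> nbhd V E I \<subseteq> V"
    using independent_sets_subset[OF assms(2)] nbhd_subset by (rule Un_least)
  have "card (V - (I \<union> nbhd V E I)) = card V - card (I \<union> nbhd V E I)"
    using finite_subset[OF covered assms(1)] covered by (rule card_Diff_subset)
  moreover have "card (I \<union> nbhd V E I) \<le> card V"
    using assms(1) covered by (rule card_mono)
  moreover have "V - I - nbhd V E I = V - (I \<union> nbhd V E I)" by blast
  ultimately show ?thesis by (simp add: acoef_def of_nat_diff)
qed

subsection \<open>The weights\<close>

lemma sum_bcoef_Diff:
  assumes "finite I"
  shows "(\<Sum>v\<in>I. bcoef V E (I - {v})) = (real (card V) - acoef V E I) * bcoef V E I"
proof (cases "I = {}")
  case True
  then show ?thesis by (simp add: acoef_def nbhd_def)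
next
  case False
  then have "0 < card I" using assms by (simp add: card_gt_0_iff)
  then have "real (card V) - acoef V E I \<noteq> 0" by (simp add: acoef_def)
  then show ?thesis using bcoef_rec[OF False, of V E] by simp
qed

lemma sum_bcoef_Diff_nbhd:
  assumes "finite V" "I \<in> independent_sets V E"
  shows "(\<Sum>x\<in>V - nbhd V E I. bcoef V E (I - {x})) = real (card V) * bcoef V E I"
proof -
  let ?free = "V - I - nbhd V E I"
  have "finite I" using assms by (rule independent_sets_imp_finite)
  have "V - nbhd V E I = ?free \<union> I"
    using independent_sets_subset[OF assms(2)] independent_sets_disjoint_nbhd[OF assms(2)] by blast
  then have "(\<Sum>x\<in>V - nbhd V E I. bcoef V E (I - {x}))
      = (\<Sum>x\<in>?free \<union> I. bcoef V E (I - {x}))"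
    by (simp only:)
  also have "\<dots> = (\<Sum>x\<in>?free. bcoef V E (I - {x})) + (\<Sum>x\<in>I. bcoef V E (I - {x}))"
    using assms(1) \<open>finite I\<close> by (intro sum.union_disjoint) auto
  also have "(\<Sum>x\<in>?free. bcoef V E (I - {x})) = acoef V E I * bcoef V E I"
    by (simp add: acoef_eq_card[OF assms])
  also have "(\<Sum>x\<in>I. bcoef V E (I - {x})) = (real (card V) - acoef V E I) * bcoef V E I"
    using \<open>finite I\<close> by (rule sum_bcoef_Diff)
  finally show ?thesis by (simp add: algebra_simps)
qed

lemma bcoef_Diff_vertex:
  assumes "finite I" "x \<notin> nbhd V E I"
  shows "bcoef (V - {x}) E I = bcoef V E I"
  using assms
proof (induction I rule: finite_psubset_induct)
  case (psubset I)
  show ?case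
  proof (cases "I = {}")
    case False
    have "bcoef (V - {x}) E (I - {v}) = bcoef V E (I - {v})" if "v \<in> I" for v
      using that psubset.prems nbhd_mono[of "I - {v}" I V E] by (intro psubset.IH) auto
    then show ?thesis
      using False psubset.prems by (simp add: bcoef_rec acoef_def nbhd_Diff_vertex)
  qed (simp add: bcoef_empty)
qed

subsection \<open>Removing the first vertex of an ordering\<close>

lemma orderings_iff:
  "\<pi> \<in> orderings V \<longleftrightarrow> \<pi> \<in> extensional V \<and> bij_betw \<pi> V {1..card V}"
  by (auto simp: orderings_def PiE_def dest: bij_betwE)

lemma finite_orderings: "finite V \<Longrightarrow> finite (orderings V)"
  by (rule finite_subset[of _ "V \<rightarrow>\<^sub>E {1..card V}"]) (auto simp: orderings_def intro: finite_PiE)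

lemma ordering_pos: "\<pi> \<in> orderings V \<Longrightarrow> v \<in> V \<Longrightarrow> 0 < \<pi> v"
  by (auto simp: orderings_iff dest: bij_betw_apply)

lemma ordering_eq_iff:
  "\<pi> \<in> orderings V \<Longrightarrow> u \<in> V \<Longrightarrow> v \<in> V \<Longrightarrow> \<pi> u = \<pi> v \<longleftrightarrow> u = v"
  by (auto simp: orderings_iff bij_betw_def inj_on_eq_iff)

lemma ordering_first_exists:
  assumes "\<pi> \<in> orderings V" "finite V" "V \<noteq> {}"
  shows "\<exists>x\<in>V. \<pi> x = 1"
proof -
  have "\<pi> ` V = {1..card V}" using assms(1) by (simp add: orderings_iff bij_betw_def)
  moreover have "1 \<in> {1..card V}" using assms(2,3) by (simp add: Suc_le_eq card_gt_0_iff)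
  ultimately show ?thesis by (metis imageE)
qed

lemma ordering_first_less:
  assumes "\<pi> \<in> orderings V" "x \<in> V" "\<pi> x = 1" "v \<in> V" "v \<noteq> x"
  shows "1 < \<pi> v"
  using ordering_eq_iff[OF assms(1,4,2)] ordering_pos[OF assms(1,4)] assms(3,5) by linarith

definition remove_first :: "'a set \<Rightarrow> 'a \<Rightarrow> ('a \<Rightarrow> nat) \<Rightarrow> 'a \<Rightarrow> nat" where
  "remove_first V x \<pi> = (\<lambda>v\<in>V - {x}. \<pi> v - 1)"

definition insert_first :: "'a set \<Rightarrow> 'a \<Rightarrow> ('a \<Rightarrow> nat) \<Rightarrow> 'a \<Rightarrow> nat" where
  "insert_first V x \<sigma> = (\<lambda>v\<in>V. if v = x then 1 else \<sigma> v + 1)"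

lemma remove_first_in_orderings:
  assumes "finite V" "x \<in> V" "\<pi> \<in> orderings V" "\<pi> x = 1"
  shows "remove_first V x \<pi> \<in> orderings (V - {x})"
proof -
  have "bij_betw \<pi> (V - {x}) ({1..card V} - {1})"
    using assms card_gt_0_iff[of V] by (intro bij_betw_DiffI) (auto simp: orderings_iff dest: bij_betwE)
  moreover have "bij_betw (\<lambda>i. i - 1) ({1..card V} - {1}) {1..card (V - {x})}"
    using assms(1,2) by (intro bij_betw_byWitness[where f' = Suc]) (auto simp: card_Diff_singleton)
  ultimately have "bij_betw ((\<lambda>i. i - 1) \<circ> \<pi>) (V - {x}) {1..card (V - {x})}"
    by (rule bij_betw_trans)
  then show ?thesis
    by (simp add: orderings_iff remove_first_def comp_def)
qed

lemma insert_first_in_orderings: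
  assumes "finite V" "x \<in> V" "\<sigma> \<in> orderings (V - {x})"
  shows "insert_first V x \<sigma> \<in> orderings V"
proof -
  let ?\<pi> = "\<lambda>v. if v = x then 1 else \<sigma> v + 1"
  have "bij_betw Suc {1..card (V - {x})} {2..card V}"
    using assms(1,2)
    by (intro bij_betw_byWitness[where f' = "\<lambda>i. i - 1"]) (auto simp: card_Diff_singleton)
  then have "bij_betw (Suc \<circ> \<sigma>) (V - {x}) {2..card V}"
    using assms(3) by (auto simp: orderings_iff intro: bij_betw_trans)
  then have "bij_betw ?\<pi> (V - {x}) {2..card V}"
    by (rule bij_betw_cong[THEN iffD1, rotated]) simp
  then have "bij_betw ?\<pi> (V - {x} \<union> {x}) ({2..card V} \<union> {1})"
    by (intro bij_betw_combine) (auto simp: bij_betw_def)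
  moreover have "V - {x} \<union> {x} = V" using assms(2) by blast
  moreover have "{2..card V} \<union> {1} = {1..card V}"
    using assms(1,2) card_gt_0_iff[of V] by auto
  ultimately show ?thesis
    by (simp add: orderings_iff insert_first_def del: Un_insert_right)
qed

lemma insert_remove_first:
  assumes "\<pi> \<in> orderings V" "\<pi> x = 1"
  shows "insert_first V x (remove_first V x \<pi>) = \<pi>"
proof -
  have "\<pi> \<in> extensional V" using assms(1) by (simp add: orderings_iff)
  then show ?thesis
    using assms(2) ordering_pos[OF assms(1)]
    by (auto simp: insert_first_def remove_first_def fun_eq_iff extensional_def)
qed

lemma remove_insert_first:
  "\<sigma> \<in> orderings (V - {x}) \<Longrightarrow> remove_first V x (insert_first V x \<sigma>) = \<sigma>"
  by (auto simp: insert_first_def remove_first_def orderings_iff fun_eq_iff extensional_def)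

lemma bij_betw_remove_first:
  assumes "finite V" "x \<in> V"
  shows "bij_betw (remove_first V x) {\<pi> \<in> orderings V. \<pi> x = 1} (orderings (V - {x}))"
proof (rule bij_betw_byWitness[where f' = "insert_first V x"])
  show "insert_first V x ` orderings (V - {x}) \<subseteq> {\<pi> \<in> orderings V. \<pi> x = 1}"
    using assms by (auto simp: insert_first_in_orderings) (simp add: insert_first_def)
qed (use assms in \<open>auto simp: insert_remove_first remove_insert_first remove_first_in_orderings\<close>)

lemma remove_first_less_iff:
  assumes "\<pi> \<in> orderings V" "u \<in> V - {x}" "v \<in> V - {x}"
  shows "remove_first V x \<pi> u < remove_first V x \<pi> v \<longleftrightarrow> \<pi> u < \<pi> v"
  using assms ordering_pos[OF assms(1), of u] ordering_pos[OF assms(1), of v]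
  by (auto simp: remove_first_def)

subsection \<open>Orderings in which a set precedes its neighbourhood\<close>

definition precedes_nbhd :: "'a set \<Rightarrow> 'a set set \<Rightarrow> 'a set \<Rightarrow> ('a \<Rightarrow> nat) \<Rightarrow> bool" where
  "precedes_nbhd V E I \<pi> \<longleftrightarrow> (\<forall>v\<in>I. \<forall>u\<in>V. adjacent E u v \<longrightarrow> \<pi> v < \<pi> u)"

definition num_orderings_preceding_nbhd :: "'a set \<Rightarrow> 'a set set \<Rightarrow> 'a set \<Rightarrow> nat" where
  "num_orderings_preceding_nbhd V E I = card {\<pi> \<in> orderings V. precedes_nbhd V E I \<pi>}"

lemma precedes_nbhd_first_not_in_nbhd:
  assumes "\<pi> \<in> orderings V" "precedes_nbhd V E I \<pi>" "I \<subseteq> V" "\<pi> x = 1"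
  shows "x \<notin> nbhd V E I"
  using assms ordering_pos[OF assms(1)] by (fastforce simp: nbhd_def precedes_nbhd_def)

lemma precedes_nbhd_remove_first:
  assumes \<pi>: "\<pi> \<in> orderings V" "\<pi> x = 1" and x: "x \<in> V" "x \<notin> nbhd V E I" and "I \<subseteq> V"
  shows "precedes_nbhd (V - {x}) E (I - {x}) (remove_first V x \<pi>) \<longleftrightarrow> precedes_nbhd V E I \<pi>"
proof -
  have "precedes_nbhd (V - {x}) E (I - {x}) (remove_first V x \<pi>)
      \<longleftrightarrow> (\<forall>v\<in>I - {x}. \<forall>u\<in>V - {x}. adjacent E u v \<longrightarrow> \<pi> v < \<pi> u)"
    unfolding precedes_nbhd_def using \<open>I \<subseteq> V\<close>
    by (intro ball_cong refl imp_cong remove_first_less_iff[OF \<pi>(1)]) auto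
  moreover have "u \<noteq> x" if "v \<in> I" "adjacent E u v" for u v
    using x that by (auto simp: nbhd_def)
  moreover have "\<pi> x < \<pi> u" if "u \<in> V" "u \<noteq> x" for u
    using ordering_first_less[OF \<pi>(1) x(1) \<pi>(2) that] \<pi>(2) by simp
  ultimately show ?thesis unfolding precedes_nbhd_def by blast
qed

lemma card_precedes_nbhd_first_eq:
  assumes "finite V" "x \<in> V" "x \<notin> nbhd V E I" "I \<subseteq> V"
  shows "card {\<pi> \<in> orderings V. precedes_nbhd V E I \<pi> \<and> \<pi> x = 1}
       = num_orderings_preceding_nbhd (V - {x}) E (I - {x})"
proof -
  have "bij_betw (remove_first V x)
      {\<pi> \<in> {\<pi> \<in> orderings V. \<pi> x = 1}. precedes_nbhd V E I \<pi>}
      {\<sigma> \<in> orderings (V - {x}). precedes_nbhd (V - {x}) E (I - {x}) \<sigma>}"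
    using assms by (intro bij_betw_Collect bij_betw_remove_first) (auto simp: precedes_nbhd_remove_first)
  from bij_betw_same_card[OF this] show ?thesis
    by (simp add: num_orderings_preceding_nbhd_def conj_ac)
qed

lemma card_precedes_nbhd_first_in:
  assumes "finite V" "I \<subseteq> V" "A \<subseteq> V"
  shows "card {\<pi> \<in> orderings V. precedes_nbhd V E I \<pi> \<and> (\<exists>x\<in>A. \<pi> x = 1)}
       = (\<Sum>x\<in>A - nbhd V E I. num_orderings_preceding_nbhd (V - {x}) E (I - {x}))"
proof -
  let ?S = "\<lambda>x. {\<pi> \<in> orderings V. precedes_nbhd V E I \<pi> \<and> \<pi> x = 1}"
  have "{\<pi> \<in> orderings V. precedes_nbhd V E I \<pi> \<and> (\<exists>x\<in>A. \<pi> x = 1)} = (\<Union>x\<in>A - nbhd V E I. ?S x)"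
    using precedes_nbhd_first_not_in_nbhd[OF _ _ assms(2)] by auto
  moreover have "card (\<Union>x\<in>A - nbhd V E I. ?S x) = (\<Sum>x\<in>A - nbhd V E I. card (?S x))"
  proof (rule card_UN_disjoint)
    show "finite (A - nbhd V E I)" using assms(1,3) finite_subset by blast
    show "\<forall>x\<in>A - nbhd V E I. finite (?S x)" using finite_orderings[OF assms(1)] by simp
    have "x = y" if "x \<in> A" "y \<in> A" "\<pi> \<in> ?S x" "\<pi> \<in> ?S y" for x y \<pi>
      using that assms(3) ordering_eq_iff[of \<pi> V x y] by auto
    then show "\<forall>x\<in>A - nbhd V E I. \<forall>y\<in>A - nbhd V E I. x \<noteq> y \<longrightarrow> ?S x \<inter> ?S y = {}"
      by blast
  qed
  ultimately show ?thesis
    using assms card_precedes_nbhd_first_eq[OF assms(1) _ _ assms(2)] by (simp add: subset_eq)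
qed

lemma num_orderings_preceding_nbhd_eq:
  assumes "finite V" "I \<in> independent_sets V E"
  shows "real (num_orderings_preceding_nbhd V E I) = fact (card V) * bcoef V E I"
  using assms
proof (induction V arbitrary: I rule: finite_psubset_induct)
  case (psubset V)
  have I: "I \<subseteq> V" using psubset.prems by (rule independent_sets_subset)
  show ?case
  proof (cases "V = {}")
    case True
    then have "{\<pi> \<in> orderings V. precedes_nbhd V E I \<pi>} = {\<lambda>_. undefined}"
      using I by (auto simp: orderings_iff precedes_nbhd_def bij_betw_def)
    then show ?thesis
      using True I by (simp add: num_orderings_preceding_nbhd_def bcoef_empty)
  next
    case False
    have remaining: "real (num_orderings_preceding_nbhd (V - {x}) E (I - {x}))
        = fact (card V - 1) * bcoef V E (I - {x})" if "x \<in> V - nbhd V E I" for x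
    proof -
      have "bcoef (V - {x}) E (I - {x}) = bcoef V E (I - {x})"
        using that psubset.hyps I finite_subset nbhd_mono[of "I - {x}" I V E]
        by (intro bcoef_Diff_vertex) auto
      then show ?thesis
        using that psubset.IH[of "V - {x}" "I - {x}"] independent_sets_Diff_vertex[OF psubset.prems]
        by (auto simp: card_Diff_singleton)
    qed
    have "{\<pi> \<in> orderings V. precedes_nbhd V E I \<pi>}
        = {\<pi> \<in> orderings V. precedes_nbhd V E I \<pi> \<and> (\<exists>x\<in>V. \<pi> x = 1)}"
      using ordering_first_exists[OF _ psubset.hyps False] by blast
    then have "real (num_orderings_preceding_nbhd V E I)
        = (\<Sum>x\<in>V - nbhd V E I. fact (card V - 1) * bcoef V E (I - {x}))"
      using card_precedes_nbhd_first_in[OF psubset.hyps I order_refl] remaining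
      by (simp add: num_orderings_preceding_nbhd_def)
    also have "\<dots> = fact (card V - 1) * (real (card V) * bcoef V E I)"
      using sum_bcoef_Diff_nbhd[OF psubset.hyps psubset.prems] by (simp flip: sum_distrib_left)
    also have "\<dots> = fact (card V) * bcoef V E I"
      using psubset.hyps False by (simp add: fact_reduce card_gt_0_iff)
    finally show ?thesis .
  qed
qed

subsection \<open>Orderings with prescribed bad vertices\<close>

lemma subset_bad_vertices_iff:
  assumes "\<pi> \<in> orderings V" "finite V" "V \<noteq> {}" "I \<subseteq> V"
  shows "I \<subseteq> bad_vertices V E \<pi> \<longleftrightarrow> precedes_nbhd V E I \<pi> \<and> (\<exists>x\<in>V - I. \<pi> x = 1)"
proof -
  obtain x where x: "x \<in> V" "\<pi> x = 1" using ordering_first_exists[OF assms(1-3)] by blast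
  then have "v \<in> V \<Longrightarrow> \<pi> v = 1 \<longleftrightarrow> v = x" for v
    using ordering_eq_iff[OF assms(1), of v x] by auto
  then show ?thesis
    using x assms(4) by (auto simp: bad_vertices_def precedes_nbhd_def)
qed

lemma card_orderings_subset_bad_vertices:
  assumes "finite V" "V \<noteq> {}" "I \<in> independent_sets V E"
  shows "real (card {\<pi> \<in> orderings V. I \<subseteq> bad_vertices V E \<pi>}) = fact (card V) * wcoef V E I"
proof -
  have I: "I \<subseteq> V" "finite I"
    using independent_sets_subset[OF assms(3)] independent_sets_imp_finite[OF assms(1,3)] .
  have remaining: "real (num_orderings_preceding_nbhd (V - {x}) E (I - {x}))
      = fact (card V - 1) * bcoef V E I" if "x \<in> V - I - nbhd V E I" for x
    using that assms(1) I(2) independent_sets_Diff_vertex[OF assms(3), of x]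
    by (simp add: num_orderings_preceding_nbhd_eq bcoef_Diff_vertex card_Diff_singleton)
  have "{\<pi> \<in> orderings V. I \<subseteq> bad_vertices V E \<pi>}
      = {\<pi> \<in> orderings V. precedes_nbhd V E I \<pi> \<and> (\<exists>x\<in>V - I. \<pi> x = 1)}"
    using subset_bad_vertices_iff[OF _ assms(1,2) I(1)] by blast
  then have "real (card {\<pi> \<in> orderings V. I \<subseteq> bad_vertices V E \<pi>})
      = (\<Sum>x\<in>V - I - nbhd V E I. fact (card V - 1) * bcoef V E I)"
    using card_precedes_nbhd_first_in[OF assms(1) I(1), of "V - I" E] remaining by simp
  also have "\<dots> = acoef V E I * (fact (card V - 1) * bcoef V E I)"
    by (simp add: acoef_eq_card[OF assms(1,3)])
  also have "\<dots> = fact (card V) * wcoef V E I"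
    using assms(1,2) by (simp add: wcoef_def fact_reduce card_gt_0_iff)
  finally show ?thesis .
qed

subsection \<open>The successive ordering polynomial\<close>

lemma sum_Pow_power_card:
  fixes x :: "'b :: comm_semiring_1"
  assumes "finite B"
  shows "(\<Sum>I\<in>Pow B. x ^ card I) = (1 + x) ^ card B"
  using prod_add[OF assms, of "\<lambda>_. x" "\<lambda>_. 1"] by (simp add: add.commute)

lemma successive_poly_eq_sum_orderings:
  assumes "finite V" "V \<noteq> {}"
  shows "smult (fact (card V)) (successive_poly V E)
       = (\<Sum>\<pi>\<in>orderings V. (1 + monom 1 1) ^ card (bad_vertices V E \<pi>))"
proof -
  let ?bad = "bad_vertices V E" and ?X = "monom 1 1 :: real poly"
  have "smult (fact (card V)) (successive_poly V E)
      = (\<Sum>I\<in>independent_sets V E. smult (fact (card V) * wcoef V E I) (?X ^ card I))"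
    by (intro poly_eqI)
      (simp add: successive_poly_def coeff_sum sum_distrib_left monom_power if_distrib cong: if_cong)
  also have "\<dots> = (\<Sum>I\<in>independent_sets V E. \<Sum>\<pi> | \<pi> \<in> orderings V \<and> I \<subseteq> ?bad \<pi>. ?X ^ card I)"
    by (intro sum.cong refl)
      (simp add: of_nat_mult_conv_smult flip: card_orderings_subset_bad_vertices[OF assms])
  also have "\<dots> = (\<Sum>\<pi>\<in>orderings V. \<Sum>I | I \<in> independent_sets V E \<and> I \<subseteq> ?bad \<pi>. ?X ^ card I)"
    using finite_independent_sets[OF assms(1)] finite_orderings[OF assms(1)]
    by (rule sum.swap_restrict)
  also have "\<dots> = (\<Sum>\<pi>\<in>orderings V. \<Sum>I\<in>Pow (?bad \<pi>). ?X ^ card I)"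
    using independent_sets_mono[OF bad_vertices_independent] by (intro sum.cong) auto
  also have "\<dots> = (\<Sum>\<pi>\<in>orderings V. (1 + ?X) ^ card (?bad \<pi>))"
    using assms(1) by (simp add: sum_Pow_power_card finite_bad_vertices)
  finally show ?thesis .
qed

lemma pcompose_power: "pcompose (p ^ m) q = pcompose p q ^ m"
  for p q :: "'b :: comm_semiring_1 poly"
  by (induction m) (simp_all add: pcompose_1 pcompose_mult)

lemma coeff_pcompose_successive_poly:
  assumes "finite V" "V \<noteq> {}"
  shows "coeff (pcompose (smult (fact (card V)) (successive_poly V E)) [:-1, 1:]) k
       = real (num_orderings_bad V E k)"
proof -
  have "pcompose (1 + monom 1 1) [:-1, 1:] = (monom 1 1 :: real poly)"
    by (simp add: monom_altdef pcompose_pCons one_pCons)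
  then have "pcompose (smult (fact (card V)) (successive_poly V E)) [:-1, 1:]
      = (\<Sum>\<pi>\<in>orderings V. monom 1 (card (bad_vertices V E \<pi>)))"
    by (simp add: successive_poly_eq_sum_orderings[OF assms] pcompose_sum pcompose_power monom_power)
  then show ?thesis
    using finite_orderings[OF assms(1)]
    by (simp add: coeff_sum num_orderings_bad_def sum.If_cases Int_def)
qed

lemma higher_pderiv_pcompose_shift:
  "(pderiv ^^ k) (pcompose p [:a, 1:]) = pcompose ((pderiv ^^ k) p) [:a, 1:]"
  by (induction k) (simp_all add: pderiv_pcompose pderiv_pCons)

lemma poly_higher_pderiv_eq_coeff_pcompose:
  fixes p :: "'b :: {idom, semiring_char_0} poly"
  shows "poly ((pderiv ^^ k) p) a = fact k * coeff (pcompose p [:a, 1:]) k"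
proof -
  have "poly ((pderiv ^^ k) p) a = coeff ((pderiv ^^ k) (pcompose p [:a, 1:])) 0"
    by (simp add: higher_pderiv_pcompose_shift poly_pcompose flip: poly_0_coeff_0)
  then show ?thesis by (simp add: coeff_higher_pderiv pochhammer_fact)
qed

theorem theorem5p3:
  fixes V :: "'a set" and E :: "'a set set" and F :: "real poly"
  assumes "finite_graph V E" and "card V \<ge> 1"
    and "F = smult (fact (card V)) (successive_poly V E)"
  shows "(\<forall>k. real (num_orderings_bad V E k) = poly ((pderiv ^^ k) F) (-1) / fact k)
         \<and> num_orderings_bad V E 0 = num_successive V E"
proof (intro conjI allI)
  have V: "finite V" "V \<noteq> {}"
    using assms(1,2) by (auto simp: finite_graph_def)
  show "real (num_orderings_bad V E k) = poly ((pderiv ^^ k) F) (-1) / fact k" for k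
    using coeff_pcompose_successive_poly[OF V, of E k] assms(3)
    by (simp add: poly_higher_pderiv_eq_coeff_pcompose)
  show "num_orderings_bad V E 0 = num_successive V E"
    using finite_bad_vertices[OF V(1)]
    by (simp add: num_orderings_bad_def num_successive_def successive_def)
qed

end
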